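(* Let $f_k(x,\theta)$, $k=1,\ldots,K$, $\theta\in\Theta\subset\mathbb{R}^p$, be parametric families of class densities on the feature space $\mathcal{X}$, let $\pi_1,\ldots,\pi_K$ be prior class probabilities, and let $\lambda(\theta)$ be a proper prior density on $\Theta$, i.e. $\lambda\ge0$ and $\int_\Theta\lambda(\theta)\,d\theta=1$. Let $\lambda(\theta\mid z)$ be the posterior density for $\theta$ given the training set $Z=z$, and define the predictive class densities $$g_k(x,z)=\int_\Theta f_k(x,\theta)\,\lambda(\theta\mid z)\,d\theta,\qquad k=1,\ldots,K,$$ and $$P(k\mid x,z)=\frac{\pi_kg_k(x,z)}{\sum_{t=1}^K\pi_tg_t(x,z)},\qquad k=1,\ldots,K.$$ Then the rule $$\widehat C(x;z)=\begin{cases}D&\text{if every }P(k\mid x,z)\le1-c,\\ k&\text{if }P(k\mid x,z)=\max_{t\le K}P(t\mid x,z)>1-c\end{cases}$$ (ties broken arbitrarily) minimises the total risk $$R(C^*,\lambda)=\int_\Theta R(C^*,\theta)\,\lambda(\theta)\,d\theta$$ among all classification rules $C^*=C^*(x;z)$ taking values in $\{1,\ldots,K,D\}$.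
   Context: Setting. $\mathcal{X}$ carries a $\sigma$-finite measure $\mu$ with respect to which densities are taken. The true class $C$ of a new feature vector $X$ satisfies $\Pr\{C=k\}=\pi_k$, independently of the training set $Z$ and of $\theta$; given $C=k$ and $\theta$, $X$ has density $f_k(\cdot,\theta)$ and is independent of $Z$. The training set is $Z=\{X_j^{(k)}:j=1,\ldots,n_k,\ k=1,\ldots,K\}$, of total size $N=\sum_kn_k$; given $\theta$ its members are independent with $X_j^{(k)}$ having density $f_k(\cdot,\theta)$, so that $Z$ has density $h(z,\theta)=\prod_{k=1}^K\prod_{j=1}^{n_k}f_k(x_j^{(k)},\theta)$. The posterior density is $\lambda(\theta\mid z)=\lambda(\theta)h(z,\theta)/\int_\Theta\lambda(\theta')h(z,\theta')\,d\theta'$. All functions are assumed measurable. A classification rule is a (measurable) map $C^*:\mathcal{X}\times\mathcal{X}^N\to\{1,\ldots,K,D\}$, where $D$ denotes the decision ``doubt''. The loss when the true class is $k$, the parameter is $\theta$ and the decision is $t$ is $$L[(k,\theta),t]=\begin{cases}0&\text{if }t=k,\\1&\text{if }t\neq k\text{ and }t\in\{1,\ldots,K\},\\c&\text{if }t=D,\end{cases}$$ where $c\ge0$ is a fixed constant. The risk as a function of $\theta$ is $$R(C^*,\theta)=\sum_{k=1}^K\pi_k\,E_{k,\theta}L[(k,\theta),C^*(X;Z)],$$ where $E_{k,\theta}$ is expectation with respect to the joint distribution of $(X,Z)$ when $X$ has class $k$ and the parameter value is $\theta$. *)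

theory Defs
  imports "HOL-Analysis.Analysis"
begin

text \<open>
  Conventions: \<open>M\<close> is the feature space with its dominating measure, classes are the naturals
  \<open>1, \<dots>, K\<close>, \<open>n k\<close> is the number of training vectors of class \<open>k\<close>, \<open>f k x \<theta>\<close> is the class density,
  \<open>w k\<close> is the prior probability \<open>\<pi>\<^sub>k\<close> of class \<open>k\<close>, and \<open>lam\<close> is the prior density on \<open>\<Theta>\<close> with respect
  to Lebesgue measure.  A training set \<open>z\<close> is a function on pairs, \<open>z (k, j)\<close> being the \<open>j\<close>-th
  training vector of class \<open>k\<close>.
\<close>

datatype decision = Class nat | Doubt

definition decisions :: "nat \<Rightarrow> decision set" where
  "decisions K = insert Doubt (Class ` {1..K})"

definition loss :: "real \<Rightarrow> nat \<times> 'p \<Rightarrow> decision \<Rightarrow> real" where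
  "loss c s t = (case t of Class l \<Rightarrow> (if l = fst s then 0 else 1) | Doubt \<Rightarrow> c)"

definition training_index :: "nat \<Rightarrow> (nat \<Rightarrow> nat) \<Rightarrow> (nat \<times> nat) set" where
  "training_index K n = (SIGMA k:{1..K}. {1..n k})"

definition training_space ::
  "'x measure \<Rightarrow> nat \<Rightarrow> (nat \<Rightarrow> nat) \<Rightarrow> (nat \<times> nat \<Rightarrow> 'x) measure" where
  "training_space M K n = (\<Pi>\<^sub>M i\<in>training_index K n. M)"

definition class_law ::
  "'x measure \<Rightarrow> (nat \<Rightarrow> 'x \<Rightarrow> 'p \<Rightarrow> real) \<Rightarrow> nat \<Rightarrow> 'p \<Rightarrow> 'x measure" where
  "class_law M f k \<theta> = density M (\<lambda>x. ennreal (f k x \<theta>))"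

definition training_law ::
  "'x measure \<Rightarrow> nat \<Rightarrow> (nat \<Rightarrow> nat) \<Rightarrow> (nat \<Rightarrow> 'x \<Rightarrow> 'p \<Rightarrow> real) \<Rightarrow> 'p
    \<Rightarrow> (nat \<times> nat \<Rightarrow> 'x) measure" where
  "training_law M K n f \<theta> = (\<Pi>\<^sub>M i\<in>training_index K n. class_law M f (fst i) \<theta>)"

text \<open>The joint law of \<open>(X, Z)\<close> when \<open>X\<close> has class \<open>k\<close> and the parameter is \<open>\<theta>\<close>; it is a product
  because \<open>X\<close> is independent of \<open>Z\<close> in that case.\<close>

definition joint_law ::
  "'x measure \<Rightarrow> nat \<Rightarrow> (nat \<Rightarrow> nat) \<Rightarrow> (nat \<Rightarrow> 'x \<Rightarrow> 'p \<Rightarrow> real) \<Rightarrow> nat \<Rightarrow> 'p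
    \<Rightarrow> ('x \<times> (nat \<times> nat \<Rightarrow> 'x)) measure" where
  "joint_law M K n f k \<theta> = class_law M f k \<theta> \<Otimes>\<^sub>M training_law M K n f \<theta>"

definition classification_rule ::
  "'x measure \<Rightarrow> nat \<Rightarrow> (nat \<Rightarrow> nat) \<Rightarrow> ('x \<Rightarrow> (nat \<times> nat \<Rightarrow> 'x) \<Rightarrow> decision) \<Rightarrow> bool" where
  "classification_rule M K n C \<longleftrightarrow>
    (\<lambda>(x, z). C x z) \<in> measurable (M \<Otimes>\<^sub>M training_space M K n) (count_space (decisions K))"

definition risk ::
  "'x measure \<Rightarrow> nat \<Rightarrow> (nat \<Rightarrow> nat) \<Rightarrow> (nat \<Rightarrow> 'x \<Rightarrow> 'p \<Rightarrow> real) \<Rightarrow> (nat \<Rightarrow> real) \<Rightarrow> real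
    \<Rightarrow> ('x \<Rightarrow> (nat \<times> nat \<Rightarrow> 'x) \<Rightarrow> decision) \<Rightarrow> 'p \<Rightarrow> real" where
  "risk M K n f w c C \<theta> =
    (\<Sum>k=1..K. w k * (LINT (x, z)|joint_law M K n f k \<theta>. loss c (k, \<theta>) (C x z)))"

text \<open>All the Bochner integrals in \<open>risk\<close> and \<open>total_risk\<close> exist for classification rules, since the
  loss takes only finitely many values and the measures involved are probability measures.\<close>

definition total_risk ::
  "'x measure \<Rightarrow> nat \<Rightarrow> (nat \<Rightarrow> nat) \<Rightarrow> (nat \<Rightarrow> 'x \<Rightarrow> real ^ 'p \<Rightarrow> real) \<Rightarrow> (nat \<Rightarrow> real) \<Rightarrow> real
    \<Rightarrow> (real ^ 'p) set \<Rightarrow> (real ^ 'p \<Rightarrow> real)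
    \<Rightarrow> ('x \<Rightarrow> (nat \<times> nat \<Rightarrow> 'x) \<Rightarrow> decision) \<Rightarrow> real" where
  "total_risk M K n f w c \<Theta> lam C =
    (LINT \<theta>|lebesgue_on \<Theta>. risk M K n f w c C \<theta> * lam \<theta>)"

definition likelihood ::
  "nat \<Rightarrow> (nat \<Rightarrow> nat) \<Rightarrow> (nat \<Rightarrow> 'x \<Rightarrow> 'p \<Rightarrow> real) \<Rightarrow> (nat \<times> nat \<Rightarrow> 'x) \<Rightarrow> 'p \<Rightarrow> real" where
  "likelihood K n f z \<theta> = (\<Prod>k=1..K. \<Prod>j=1..n k. f k (z (k, j)) \<theta>)"

text \<open>For \<open>z\<close> where the normalising integral is zero or infinite, and for \<open>(x, z)\<close> where some \<open>g\<^sub>k\<close> is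
  infinite or all \<open>\<pi>\<^sub>k g\<^sub>k\<close> vanish, the conventions for division by zero and for non-integrable functions
  make the affected quotient or integral zero.  These \<open>z\<close> and \<open>(x, z)\<close> have predictive probability zero.\<close>

definition posterior ::
  "nat \<Rightarrow> (nat \<Rightarrow> nat) \<Rightarrow> (nat \<Rightarrow> 'x \<Rightarrow> real ^ 'p \<Rightarrow> real)
    \<Rightarrow> (real ^ 'p) set \<Rightarrow> (real ^ 'p \<Rightarrow> real)
    \<Rightarrow> real ^ 'p \<Rightarrow> (nat \<times> nat \<Rightarrow> 'x) \<Rightarrow> real" where
  "posterior K n f \<Theta> lam \<theta> z =
    lam \<theta> * likelihood K n f z \<theta> / (LINT \<theta>'|lebesgue_on \<Theta>. lam \<theta>' * likelihood K n f z \<theta>')"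

definition predictive_density ::
  "nat \<Rightarrow> (nat \<Rightarrow> nat) \<Rightarrow> (nat \<Rightarrow> 'x \<Rightarrow> real ^ 'p \<Rightarrow> real)
    \<Rightarrow> (real ^ 'p) set \<Rightarrow> (real ^ 'p \<Rightarrow> real)
    \<Rightarrow> nat \<Rightarrow> 'x \<Rightarrow> (nat \<times> nat \<Rightarrow> 'x) \<Rightarrow> real" where
  "predictive_density K n f \<Theta> lam k x z =
    (LINT \<theta>|lebesgue_on \<Theta>. f k x \<theta> * posterior K n f \<Theta> lam \<theta> z)"

definition class_posterior ::
  "nat \<Rightarrow> (nat \<Rightarrow> nat) \<Rightarrow> (nat \<Rightarrow> 'x \<Rightarrow> real ^ 'p \<Rightarrow> real) \<Rightarrow> (nat \<Rightarrow> real)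
    \<Rightarrow> (real ^ 'p) set \<Rightarrow> (real ^ 'p \<Rightarrow> real)
    \<Rightarrow> nat \<Rightarrow> 'x \<Rightarrow> (nat \<times> nat \<Rightarrow> 'x) \<Rightarrow> real" where
  "class_posterior K n f w \<Theta> lam k x z =
    w k * predictive_density K n f \<Theta> lam k x z /
    (\<Sum>t=1..K. w t * predictive_density K n f \<Theta> lam t x z)"

text \<open>Ties are broken arbitrarily, so this is a predicate on rules rather than a single function.\<close>

definition predictive_rule ::
  "'x measure \<Rightarrow> nat \<Rightarrow> (nat \<Rightarrow> nat) \<Rightarrow> (nat \<Rightarrow> 'x \<Rightarrow> real ^ 'p \<Rightarrow> real) \<Rightarrow> (nat \<Rightarrow> real) \<Rightarrow> real
    \<Rightarrow> (real ^ 'p) set \<Rightarrow> (real ^ 'p \<Rightarrow> real)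
    \<Rightarrow> ('x \<Rightarrow> (nat \<times> nat \<Rightarrow> 'x) \<Rightarrow> decision) \<Rightarrow> bool" where
  "predictive_rule M K n f w c \<Theta> lam C \<longleftrightarrow>
    (\<forall>x\<in>space M. \<forall>z\<in>space (training_space M K n).
      let P = (\<lambda>k. class_posterior K n f w \<Theta> lam k x z) in
      if \<forall>k\<in>{1..K}. P k \<le> 1 - c then C x z = Doubt
      else \<exists>k\<in>{1..K}. C x z = Class k \<and> P k = Max (P ` {1..K}) \<and> P k > 1 - c)"

end

theory Submission
  imports Defs
begin

text \<open>
  The rule is a Bayes rule, and the proof is the usual two steps: average the risk over the prior, then
  minimise the integrand separately at each observation.

  For \<open>\<theta>\<close> fixed, the joint law of \<open>(X, Z)\<close> for class \<open>k\<close> has density \<open>f\<^sub>k(x, \<theta>) h(z, \<theta>)\<close> with respect to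
  the product measure \<open>N\<close> on features and training sets, where \<open>h\<close> is the likelihood
  (\<open>joint_law_eq_density\<close>).  Multiplying by the prior density and integrating over \<open>\<theta>\<close> first, which
  Fubini's theorem permits because \<open>\<lambda>(\<theta>) f\<^sub>k(x, \<theta>) h(z, \<theta>)\<close> has total mass \<open>1\<close> and the loss is bounded,
  turns the total risk of any rule \<open>C\<close> into
  \<open>\<integral> (\<Sum>\<^sub>k \<pi>\<^sub>k G\<^sub>k(x, z) L[k, C(x, z)]) dN(x, z)\<close> with
  \<open>G\<^sub>k(x, z) = \<integral> \<lambda>(\<theta>) f\<^sub>k(x, \<theta>) h(z, \<theta>) d\<theta>\<close> (\<open>total_risk_eq\<close>).

  The integrand involves \<open>C\<close> only through the single decision \<open>C(x, z)\<close>.  Write \<open>p\<^sub>k = \<pi>\<^sub>k G\<^sub>k\<close> and let \<open>S\<close>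
  be the sum of the \<open>p\<^sub>k\<close>.  Deciding for class \<open>l\<close> costs \<open>S - p\<^sub>l\<close> and doubt costs \<open>c S\<close>, so when \<open>S > 0\<close>
  the best class is the one with the largest \<open>p\<^sub>l / S\<close>, and it beats doubt exactly if
  \<open>p\<^sub>l / S > 1 - c\<close>; when \<open>S = 0\<close> every decision costs nothing
  (\<open>posterior_decision_minimises_expected_loss\<close>).

  It remains to recognise \<open>p\<^sub>l / S\<close> as \<open>P(l | x, z)\<close>.  The predictive density \<open>g\<^sub>k\<close> is \<open>G\<^sub>k\<close> divided by the
  evidence \<open>\<integral> \<lambda> h d\<theta>\<close>, a factor that cancels from the quotient provided that it is not zero.  For almost
  every \<open>z\<close> the integrand of the evidence is integrable, and then zero evidence forces all \<open>G\<^sub>k\<close> to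
  vanish, which is the harmless case \<open>S = 0\<close> (\<open>class_posterior_eq\<close>).
\<close>

section \<open>Densities of product measures and of mixtures\<close>

text \<open>
  Both sides give a box the product of the one-dimensional integrals, and a product of \<open>\<sigma>\<close>-finite
  measures is determined by its values on boxes.
\<close>

lemma (in product_sigma_finite) PiM_density:
  assumes I: "finite I"
    and g: "\<And>i. i \<in> I \<Longrightarrow> g i \<in> borel_measurable (M i)"
    and sf: "\<And>i. i \<in> I \<Longrightarrow> sigma_finite_measure (density (M i) (g i))"
  shows "(\<Pi>\<^sub>M i\<in>I. density (M i) (g i)) = density (Pi\<^sub>M I M) (\<lambda>z. \<Prod>i\<in>I. g i (z i))"
proof -
  \<comment> \<open>The uniqueness of product measures is available for families that are \<open>\<sigma>\<close>-finite at every
      index; outside \<open>I\<close> the densities may fail to be, so the original measures are used there.\<close>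
  define D where "D i = (if i \<in> I then density (M i) (g i) else M i)" for i
  have sets_D [simp]: "sets (D i) = sets (M i)" for i
    by (simp add: D_def)
  interpret D: product_sigma_finite D
    by (rule product_sigma_finite.intro) (simp add: D_def sf sigma_finite_measures)
  have "density (Pi\<^sub>M I M) (\<lambda>z. \<Prod>i\<in>I. g i (z i)) = Pi\<^sub>M I D"
  proof (rule D.PiM_eqI[OF I])
    show "sets (density (Pi\<^sub>M I M) (\<lambda>z. \<Prod>i\<in>I. g i (z i))) = sets (Pi\<^sub>M I D)"
      unfolding sets_density by (rule sets_PiM_cong) simp_all
  next
    fix A assume "\<And>i. i \<in> I \<Longrightarrow> A i \<in> sets (D i)"
    then have A: "A i \<in> sets (M i)" if "i \<in> I" for i
      using that by simp
    have "(\<lambda>z. g i (z i)) \<in> borel_measurable (Pi\<^sub>M I M)" if "i \<in> I" for i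
      by (rule measurable_compose[OF measurable_component_singleton[OF that, of M] g[OF that]])
    then have meas: "(\<lambda>z. \<Prod>i\<in>I. g i (z i)) \<in> borel_measurable (Pi\<^sub>M I M)"
      by (intro borel_measurable_prod_ennreal)
    have "emeasure (density (Pi\<^sub>M I M) (\<lambda>z. \<Prod>i\<in>I. g i (z i))) (Pi\<^sub>E I A) =
        (\<integral>\<^sup>+ z. (\<Prod>i\<in>I. g i (z i)) * indicator (Pi\<^sub>E I A) z \<partial>Pi\<^sub>M I M)"
      using A I by (intro emeasure_density meas sets_PiM_I_finite) auto
    also have "\<dots> = (\<integral>\<^sup>+ z. (\<Prod>i\<in>I. g i (z i) * indicator (A i) (z i)) \<partial>Pi\<^sub>M I M)"
    proof (rule nn_integral_cong)
      fix z assume "z \<in> space (Pi\<^sub>M I M)"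
      then have "z \<in> extensional I"
        by (auto simp: space_PiM PiE_def)
      then have "indicator (Pi\<^sub>E I A) z = (\<Prod>i\<in>I. indicator (A i) (z i) :: ennreal)"
        using I by (auto simp: indicator_def PiE_iff prod_zero_iff)
      then show "(\<Prod>i\<in>I. g i (z i)) * indicator (Pi\<^sub>E I A) z =
          (\<Prod>i\<in>I. g i (z i) * indicator (A i) (z i))"
        by (simp add: prod.distrib)
    qed
    also have "\<dots> = (\<Prod>i\<in>I. \<integral>\<^sup>+ x. g i x * indicator (A i) x \<partial>M i)"
      using I g A by (intro product_nn_integral_prod) auto
    also have "\<dots> = (\<Prod>i\<in>I. emeasure (D i) (A i))"
      using g A by (intro prod.cong refl) (simp add: D_def emeasure_density)
    finally show "emeasure (density (Pi\<^sub>M I M) (\<lambda>z. \<Prod>i\<in>I. g i (z i))) (Pi\<^sub>E I A) =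
        (\<Prod>i\<in>I. emeasure (D i) (A i))" .
  qed
  moreover have "Pi\<^sub>M I D = (\<Pi>\<^sub>M i\<in>I. density (M i) (g i))"
    by (intro PiM_cong) (auto simp: D_def)
  ultimately show ?thesis
    by simp
qed

text \<open>
  If each \<open>p(\<cdot>, \<theta>)\<close> is a probability density, then by Tonelli's theorem the mixture has the same total mass
  as its mixing density \<open>r\<close>.
\<close>

lemma (in pair_sigma_finite) integrable_mixture_density:
  fixes p :: "'a \<Rightarrow> 'b \<Rightarrow> real" and r :: "'b \<Rightarrow> real"
  assumes p_meas: "(\<lambda>(y, \<theta>). p y \<theta>) \<in> borel_measurable (M1 \<Otimes>\<^sub>M M2)"
    and p_nonneg: "\<And>y \<theta>. y \<in> space M1 \<Longrightarrow> \<theta> \<in> space M2 \<Longrightarrow> 0 \<le> p y \<theta>"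
    and p_prob: "\<And>\<theta>. \<theta> \<in> space M2 \<Longrightarrow> (\<integral>\<^sup>+ y. ennreal (p y \<theta>) \<partial>M1) = 1"
    and r: "integrable M2 r" "\<And>\<theta>. \<theta> \<in> space M2 \<Longrightarrow> 0 \<le> r \<theta>"
  shows "integrable (M1 \<Otimes>\<^sub>M M2) (\<lambda>(y, \<theta>). r \<theta> * p y \<theta>)"
proof (rule integrableI_nonneg)
  note [measurable] = p_meas borel_measurable_integrable[OF r(1)]
  show "(\<lambda>(y, \<theta>). r \<theta> * p y \<theta>) \<in> borel_measurable (M1 \<Otimes>\<^sub>M M2)"
    by measurable
  show "AE v in M1 \<Otimes>\<^sub>M M2. 0 \<le> (case v of (y, \<theta>) \<Rightarrow> r \<theta> * p y \<theta>)"
    using p_nonneg r(2) by (intro AE_I2) (auto simp: space_pair_measure)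
  have "(\<integral>\<^sup>+ v. ennreal (case v of (y, \<theta>) \<Rightarrow> r \<theta> * p y \<theta>) \<partial>(M1 \<Otimes>\<^sub>M M2)) =
      (\<integral>\<^sup>+ \<theta>. \<integral>\<^sup>+ y. ennreal (r \<theta> * p y \<theta>) \<partial>M1 \<partial>M2)"
    by (subst nn_integral_snd[symmetric]) auto
  also have "\<dots> = (\<integral>\<^sup>+ \<theta>. ennreal (r \<theta>) \<partial>M2)"
  proof (rule nn_integral_cong)
    fix \<theta> assume \<theta>: "\<theta> \<in> space M2"
    have [measurable]: "(\<lambda>y. p y \<theta>) \<in> borel_measurable M1"
      using measurable_compose[OF measurable_Pair2'[OF \<theta>] p_meas] by simp
    have "(\<integral>\<^sup>+ y. ennreal (r \<theta> * p y \<theta>) \<partial>M1) = (\<integral>\<^sup>+ y. ennreal (r \<theta>) * ennreal (p y \<theta>) \<partial>M1)"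
      using \<theta> r(2) p_nonneg by (intro nn_integral_cong) (simp add: ennreal_mult)
    also have "\<dots> = ennreal (r \<theta>)"
      by (simp add: nn_integral_cmult p_prob[OF \<theta>])
    finally show "(\<integral>\<^sup>+ y. ennreal (r \<theta> * p y \<theta>) \<partial>M1) = ennreal (r \<theta>)" .
  qed
  also have "\<dots> < \<infinity>"
    using r by (subst nn_integral_eq_integral) auto
  finally show "(\<integral>\<^sup>+ v. ennreal (case v of (y, \<theta>) \<Rightarrow> r \<theta> * p y \<theta>) \<partial>(M1 \<Otimes>\<^sub>M M2)) < \<infinity>" .
qed

text \<open>
  A countable cover by sets of finite Borel-Lebesgue measure also serves for the completion.
\<close>

lemma sigma_finite_lebesgue_on:
  fixes S :: "'a::euclidean_space set"
  assumes "S \<in> sets lebesgue"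
  shows "sigma_finite_measure (lebesgue_on S)"
proof -
  obtain A :: "'a set set"
    where A: "countable A" "A \<subseteq> sets lborel" "\<Union>A = UNIV" "\<forall>a\<in>A. emeasure lborel a \<noteq> \<infinity>"
    using lborel.sigma_finite_countable by auto
  have "sigma_finite_measure (lebesgue :: 'a measure)"
  proof (unfold_locales, intro exI conjI)
    show "A \<subseteq> sets lebesgue" "\<forall>a\<in>A. emeasure lebesgue a \<noteq> \<infinity>"
      using A by (auto simp: subset_eq)
  qed (use A in auto)
  then show ?thesis
    using assms by (rule sigma_finite_measure_restrict_space)
qed

section \<open>The optimal decision at a single observation\<close>

lemma expected_loss_Class:
  assumes "l \<in> {1..K}"
  shows "(\<Sum>k=1..K. p k * loss c (k, \<theta>) (Class l)) = (\<Sum>k=1..K. p k) - p l"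
proof -
  have "(\<Sum>k=1..K. p k * loss c (k, \<theta>) (Class l)) = (\<Sum>k=1..K. p k - (if k = l then p k else 0))"
    by (intro sum.cong) (auto simp: loss_def)
  also have "\<dots> = (\<Sum>k=1..K. p k) - p l"
    using assms by (simp add: sum_subtractf)
  finally show ?thesis .
qed

lemma expected_loss_Doubt:
  "(\<Sum>k=1..K. p k * loss c (k, \<theta>) Doubt) = c * (\<Sum>k=1..K. p k)"
  by (simp add: loss_def sum_distrib_left mult.commute)

text \<open>
  Here \<open>p k\<close> is the unnormalised posterior weight of class \<open>k\<close> and \<open>P k\<close> the number on which the rule acts.
  Let \<open>S\<close> be the sum of the weights.  If \<open>S = 0\<close> all weights vanish and every decision has expected loss
  \<open>0\<close>, so nothing is asked of \<open>P\<close>.  If \<open>S > 0\<close>, class \<open>l\<close> costs \<open>(1 - P l) S\<close> and doubt costs \<open>c S\<close>, and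
  after division by \<open>S\<close> the rule picks the smallest of the numbers \<open>c\<close> and \<open>1 - P l\<close>.
\<close>

lemma posterior_decision_minimises_expected_loss:
  fixes p :: "nat \<Rightarrow> real"
  assumes p: "\<And>k. k \<in> {1..K} \<Longrightarrow> 0 \<le> p k"
    and P: "(\<Sum>k=1..K. p k) \<noteq> 0 \<Longrightarrow> \<forall>k\<in>{1..K}. P k = p k / (\<Sum>k=1..K. p k)"
    and d: "if \<forall>k\<in>{1..K}. P k \<le> 1 - c then d = Doubt
      else \<exists>k\<in>{1..K}. d = Class k \<and> P k = Max (P ` {1..K}) \<and> P k > 1 - c"
    and t: "t \<in> decisions K"
  shows "(\<Sum>k=1..K. p k * loss c (k, \<theta>) d) \<le> (\<Sum>k=1..K. p k * loss c (k, \<theta>) t)"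
proof -
  define S where "S = (\<Sum>k=1..K. p k)"
  show ?thesis
  proof (cases "S = 0")
    case True
    then have "p k = 0" if "k \<in> {1..K}" for k
      using p that unfolding S_def by (subst (asm) sum_nonneg_eq_0_iff) auto
    then show ?thesis
      by simp
  next
    case False
    then have "S > 0"
      using p sum_nonneg[of "{1..K}" p] by (simp add: S_def less_le)
    have pP: "p k = P k * S" if "k \<in> {1..K}" for k
      using P False that by (simp add: S_def)
    have eC: "(\<Sum>k=1..K. p k * loss c (k, \<theta>) (Class l)) = (1 - P l) * S" if "l \<in> {1..K}" for l
      using expected_loss_Class[OF that, of p c \<theta>] pP[OF that] by (simp add: S_def algebra_simps)
    have eD: "(\<Sum>k=1..K. p k * loss c (k, \<theta>) Doubt) = c * S"
      unfolding S_def by (rule expected_loss_Doubt)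
    show ?thesis
    proof (cases "\<forall>k\<in>{1..K}. P k \<le> 1 - c")
      case True
      then have "d = Doubt"
        using d by simp
      moreover have "c * S \<le> (1 - P l) * S" if "l \<in> {1..K}" for l
        using True that \<open>S > 0\<close> by (intro mult_right_mono) (auto simp: algebra_simps)
      ultimately show ?thesis
        using t eC eD by (auto simp: decisions_def)
    next
      case False
      obtain k where k: "k \<in> {1..K}" "d = Class k" "P k = Max (P ` {1..K})" "P k > 1 - c"
        using d unfolding if_not_P[OF False] by blast
      have "P l \<le> P k" if "l \<in> {1..K}" for l
        unfolding k(3) using that by (intro Max_ge) auto
      then have "(1 - P k) * S \<le> (1 - P l) * S" if "l \<in> {1..K}" for l
        using that \<open>S > 0\<close> by (intro mult_right_mono) auto
      moreover have "(1 - P k) * S \<le> c * S"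
        using k \<open>S > 0\<close> by (intro mult_right_mono) auto
      ultimately show ?thesis
        using t eC eD k by (auto simp: decisions_def)
    qed
  qed
qed

section \<open>The statistical model\<close>

lemma finite_training_index: "finite (training_index K n)"
  by (simp add: training_index_def)

lemma likelihood_eq_prod:
  "likelihood K n f z \<theta> = (\<Prod>i\<in>training_index K n. f (fst i) (z i) \<theta>)"
  unfolding likelihood_def training_index_def
  by (subst prod.Sigma) (auto intro!: prod.cong)
text \<open>
  Every interchange of integrals below rests on the integrability of the prior: all the other densities
  have total mass \<open>1\<close>.
\<close>

locale parametric_classes = sigma_finite_measure M
  for M :: "'x measure" +
  fixes K :: nat and n :: "nat \<Rightarrow> nat"
    and \<Theta> :: "(real ^ 'p) set"
    and f :: "nat \<Rightarrow> 'x \<Rightarrow> real ^ 'p \<Rightarrow> real"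
    and w :: "nat \<Rightarrow> real"
    and lam :: "real ^ 'p \<Rightarrow> real"
  assumes \<Theta>_sets: "\<Theta> \<in> sets lebesgue"
    and f_meas: "\<And>k. k \<in> {1..K} \<Longrightarrow> (\<lambda>(x, \<theta>). f k x \<theta>) \<in> borel_measurable (M \<Otimes>\<^sub>M lebesgue_on \<Theta>)"
    and f_nonneg: "\<And>k x \<theta>. k \<in> {1..K} \<Longrightarrow> x \<in> space M \<Longrightarrow> \<theta> \<in> \<Theta> \<Longrightarrow> 0 \<le> f k x \<theta>"
    and f_density: "\<And>k \<theta>. k \<in> {1..K} \<Longrightarrow> \<theta> \<in> \<Theta> \<Longrightarrow> (LINT x|M. f k x \<theta>) = 1"
    and w_nonneg: "\<And>k. k \<in> {1..K} \<Longrightarrow> 0 \<le> w k"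
    and lam_nonneg: "\<And>\<theta>. \<theta> \<in> \<Theta> \<Longrightarrow> 0 \<le> lam \<theta>"
    and lam_integrable: "integrable (lebesgue_on \<Theta>) lam"
begin

abbreviation "T \<equiv> training_space M K n"
abbreviation "L \<equiv> lebesgue_on \<Theta>"
abbreviation "N \<equiv> M \<Otimes>\<^sub>M T"

lemma space_L: "space L = \<Theta>"
  using \<Theta>_sets by simp

lemma product_M: "product_sigma_finite (\<lambda>_. M)"
  by (rule product_sigma_finite.intro) (rule sigma_finite_measure_axioms)

lemma sigma_finite_L: "sigma_finite_measure L"
  by (rule sigma_finite_lebesgue_on[OF \<Theta>_sets])

lemma sigma_finite_T: "sigma_finite_measure T"
  unfolding training_space_def
  by (rule product_sigma_finite.sigma_finite[OF product_M finite_training_index])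

lemma sigma_finite_N: "sigma_finite_measure N"
  by (rule sigma_finite_pair_measure[OF sigma_finite_measure_axioms sigma_finite_T])

lemma pair_M_T: "pair_sigma_finite M T"
  by (rule pair_sigma_finite.intro[OF sigma_finite_measure_axioms sigma_finite_T])

lemma pair_T_L: "pair_sigma_finite T L"
  by (rule pair_sigma_finite.intro[OF sigma_finite_T sigma_finite_L])

lemma pair_N_L: "pair_sigma_finite N L"
  by (rule pair_sigma_finite.intro[OF sigma_finite_N sigma_finite_L])

lemma lam_measurable [measurable]: "lam \<in> borel_measurable L"
  using lam_integrable by (rule borel_measurable_integrable)

lemma class_density_measurable:
  assumes "k \<in> {1..K}" "X \<in> measurable A M" "Y \<in> measurable A L"
  shows "(\<lambda>a. f k (X a) (Y a)) \<in> borel_measurable A"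
  using measurable_compose[OF measurable_Pair[OF assms(2,3)] f_meas[OF assms(1)]] by simp

lemma training_class: "i \<in> training_index K n \<Longrightarrow> fst i \<in> {1..K}"
  by (auto simp: training_index_def)

lemma training_vector: "z \<in> space T \<Longrightarrow> i \<in> training_index K n \<Longrightarrow> z i \<in> space M"
  by (auto simp: training_space_def space_PiM)

lemma likelihood_measurable:
  assumes Z: "Z \<in> measurable A T" and Y: "Y \<in> measurable A L"
  shows "(\<lambda>a. likelihood K n f (Z a) (Y a)) \<in> borel_measurable A"
  unfolding likelihood_eq_prod
proof (intro borel_measurable_prod class_density_measurable training_class Y)
  fix i assume "i \<in> training_index K n"
  then show "(\<lambda>a. Z a i) \<in> measurable A M"
    by (intro measurable_compose[OF Z[unfolded training_space_def]] measurable_component_singleton)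
qed

lemma likelihood_nonneg: "z \<in> space T \<Longrightarrow> \<theta> \<in> \<Theta> \<Longrightarrow> 0 \<le> likelihood K n f z \<theta>"
  unfolding likelihood_eq_prod
  by (intro prod_nonneg f_nonneg training_class training_vector)

context
  fixes \<theta> assumes \<theta>: "\<theta> \<in> \<Theta>"
begin

lemma const_measurable_L: "(\<lambda>_. \<theta>) \<in> measurable A L"
  using \<theta> space_L by (intro measurable_const) simp

lemma class_density_section: "k \<in> {1..K} \<Longrightarrow> (\<lambda>x. f k x \<theta>) \<in> borel_measurable M"
  by (intro class_density_measurable const_measurable_L measurable_ident_sets[OF refl])

lemma likelihood_section: "(\<lambda>z. likelihood K n f z \<theta>) \<in> borel_measurable T"
  by (intro likelihood_measurable const_measurable_L measurable_ident_sets[OF refl])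

lemma nn_integral_class_density:
  assumes k: "k \<in> {1..K}"
  shows "(\<integral>\<^sup>+ x. ennreal (f k x \<theta>) \<partial>M) = 1"
proof -
  have "integrable M (\<lambda>x. f k x \<theta>)"
    using f_density[OF k \<theta>] not_integrable_integral_eq by fastforce
  then show ?thesis
    using f_density[OF k \<theta>] f_nonneg[OF k _ \<theta>] by (subst nn_integral_eq_integral) auto
qed

text \<open>
  The densities integrate to \<open>1\<close>, so the laws are finite measures.  Only \<open>\<sigma>\<close>-finiteness is
  recorded, being what the density formulas for product measures ask for.
\<close>

lemma sigma_finite_class_law:
  assumes k: "k \<in> {1..K}"
  shows "sigma_finite_measure (class_law M f k \<theta>)"
proof -
  have "emeasure (class_law M f k \<theta>) (space M) = 1"
    using class_density_section[OF k] nn_integral_class_density[OF k]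
    unfolding class_law_def by (subst emeasure_density) (auto cong: nn_integral_cong)
  then interpret finite_measure "class_law M f k \<theta>"
    by (intro finite_measureI) (simp add: class_law_def)
  show ?thesis ..
qed

text \<open>
  The training vectors are independent, so their laws form a product measure whose density factorises
  over the training index; the nested product in the likelihood is the same product.
\<close>

lemma training_law_eq_density:
  "training_law M K n f \<theta> = density T (\<lambda>z. ennreal (likelihood K n f z \<theta>))"
proof -
  have "training_law M K n f \<theta> =
      density T (\<lambda>z. \<Prod>i\<in>training_index K n. ennreal (f (fst i) (z i) \<theta>))"
    unfolding training_law_def training_space_def class_law_def
    by (rule product_sigma_finite.PiM_density[OF product_M finite_training_index])
      (auto intro!: measurable_compose[OF _ measurable_ennreal] class_density_section training_class
         sigma_finite_class_law[unfolded class_law_def])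
  also have "\<dots> = density T (\<lambda>z. ennreal (likelihood K n f z \<theta>))"
  proof (rule density_cong)
    show "(\<lambda>z. \<Prod>i\<in>training_index K n. ennreal (f (fst i) (z i) \<theta>)) \<in> borel_measurable T"
      unfolding training_space_def
      by (intro borel_measurable_prod_ennreal measurable_compose[OF _ measurable_ennreal]
          class_density_measurable const_measurable_L training_class measurable_component_singleton)
    show "AE z in T. (\<Prod>i\<in>training_index K n. ennreal (f (fst i) (z i) \<theta>)) =
        ennreal (likelihood K n f z \<theta>)"
      unfolding likelihood_eq_prod
      by (intro AE_I2 prod_ennreal f_nonneg training_class training_vector \<theta>)
  qed (use likelihood_section in measurable)
  finally show ?thesis .
qed

lemma nn_integral_likelihood: "(\<integral>\<^sup>+ z. ennreal (likelihood K n f z \<theta>) \<partial>T) = 1"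
proof -
  have "(\<integral>\<^sup>+ z. ennreal (likelihood K n f z \<theta>) \<partial>T) =
      (\<integral>\<^sup>+ z. (\<Prod>i\<in>training_index K n. ennreal (f (fst i) (z i) \<theta>)) \<partial>T)"
    unfolding likelihood_eq_prod
    by (intro nn_integral_cong prod_ennreal[symmetric] f_nonneg training_class training_vector \<theta>)
  also have "\<dots> = (\<Prod>i\<in>training_index K n. \<integral>\<^sup>+ x. ennreal (f (fst i) x \<theta>) \<partial>M)"
    unfolding training_space_def
    by (intro product_sigma_finite.product_nn_integral_prod[OF product_M finite_training_index]
        measurable_compose[OF _ measurable_ennreal] class_density_section training_class)
  also have "\<dots> = 1"
    by (intro prod.neutral ballI nn_integral_class_density training_class)
  finally show ?thesis .
qed

lemma sigma_finite_training_law: "sigma_finite_measure (training_law M K n f \<theta>)"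
proof -
  have "emeasure (training_law M K n f \<theta>) (space T) = 1"
    using likelihood_section nn_integral_likelihood
    unfolding training_law_eq_density by (subst emeasure_density) (auto cong: nn_integral_cong)
  then interpret finite_measure "training_law M K n f \<theta>"
    by (intro finite_measureI) (simp add: training_law_eq_density)
  show ?thesis ..
qed

lemma joint_density_section:
  assumes k: "k \<in> {1..K}"
  shows "(\<lambda>y. f k (fst y) \<theta> * likelihood K n f (snd y) \<theta>) \<in> borel_measurable N"
  by (intro borel_measurable_times class_density_measurable likelihood_measurable
      const_measurable_L k measurable_fst measurable_snd)

text \<open>
  Independence of the new vector from the training set.  This is what lets the risk be written as an
  integral against \<open>N\<close>, a measure that depends neither on the class nor on the parameter.
\<close>

lemma joint_law_eq_density:
  assumes k: "k \<in> {1..K}"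
  shows "joint_law M K n f k \<theta> =
    density N (\<lambda>y. ennreal (f k (fst y) \<theta> * likelihood K n f (snd y) \<theta>))"
proof -
  note [measurable] = class_density_section[OF k] likelihood_section joint_density_section[OF k]
  have "joint_law M K n f k \<theta> =
      density N (\<lambda>(x, z). ennreal (f k x \<theta>) * ennreal (likelihood K n f z \<theta>))"
    unfolding joint_law_def class_law_def training_law_eq_density
    by (intro pair_measure_density sigma_finite_T
        sigma_finite_training_law[unfolded training_law_eq_density]) measurable
  also have "\<dots> = density N (\<lambda>y. ennreal (f k (fst y) \<theta> * likelihood K n f (snd y) \<theta>))"
  proof (rule density_cong)
    show "AE y in N. (case y of (x, z) \<Rightarrow> ennreal (f k x \<theta>) * ennreal (likelihood K n f z \<theta>)) =
        ennreal (f k (fst y) \<theta> * likelihood K n f (snd y) \<theta>)"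
      using f_nonneg[OF k _ \<theta>] likelihood_nonneg[OF _ \<theta>]
      by (intro AE_I2) (auto simp: space_pair_measure ennreal_mult)
  qed measurable
  finally show ?thesis .
qed

lemma nn_integral_joint_density:
  assumes k: "k \<in> {1..K}"
  shows "(\<integral>\<^sup>+ y. ennreal (f k (fst y) \<theta> * likelihood K n f (snd y) \<theta>) \<partial>N) = 1"
proof -
  note [measurable] = class_density_section[OF k] likelihood_section joint_density_section[OF k]
  interpret T: sigma_finite_measure T by (rule sigma_finite_T)
  have "(\<integral>\<^sup>+ y. ennreal (f k (fst y) \<theta> * likelihood K n f (snd y) \<theta>) \<partial>N) =
      (\<integral>\<^sup>+ x. \<integral>\<^sup>+ z. ennreal (f k x \<theta> * likelihood K n f z \<theta>) \<partial>T \<partial>M)"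
    by (subst T.nn_integral_fst[symmetric]) auto
  also have "\<dots> = (\<integral>\<^sup>+ x. \<integral>\<^sup>+ z. ennreal (f k x \<theta>) * ennreal (likelihood K n f z \<theta>) \<partial>T \<partial>M)"
    using f_nonneg[OF k _ \<theta>] likelihood_nonneg[OF _ \<theta>]
    by (intro nn_integral_cong ennreal_mult)
  also have "\<dots> = 1"
    by (simp add: nn_integral_cmult nn_integral_likelihood nn_integral_class_density[OF k])
  finally show ?thesis .
qed

end

section \<open>Integrating out the parameter\<close>

text \<open>
  For a proper prior, the joint density of the parameter and the data when the new vector \<open>fst y\<close> has
  class \<open>k\<close>; \<open>snd y\<close> is the training set.
\<close>

definition joint_weight :: "nat \<Rightarrow> 'x \<times> (nat \<times> nat \<Rightarrow> 'x) \<Rightarrow> real ^ 'p \<Rightarrow> real" where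
  "joint_weight k y \<theta> = lam \<theta> * (f k (fst y) \<theta> * likelihood K n f (snd y) \<theta>)"

text \<open>
  For a proper prior, the marginal density of the data given class \<open>k\<close>.  Where the evidence is positive it
  is the predictive density multiplied by the evidence; working with it avoids dividing by an evidence
  that may be zero.
\<close>

definition predictive_mass :: "nat \<Rightarrow> 'x \<times> (nat \<times> nat \<Rightarrow> 'x) \<Rightarrow> real" where
  "predictive_mass k y = (LINT \<theta>|L. joint_weight k y \<theta>)"

definition evidence :: "(nat \<times> nat \<Rightarrow> 'x) \<Rightarrow> real" where
  "evidence z = (LINT \<theta>|L. lam \<theta> * likelihood K n f z \<theta>)"

lemma joint_weight_integrable:
  assumes k: "k \<in> {1..K}"
  shows "integrable (N \<Otimes>\<^sub>M L) (\<lambda>(y, \<theta>). joint_weight k y \<theta>)"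
  unfolding joint_weight_def
proof (rule pair_sigma_finite.integrable_mixture_density[OF pair_N_L])
  show "(\<lambda>(y, \<theta>). f k (fst y) \<theta> * likelihood K n f (snd y) \<theta>) \<in> borel_measurable (N \<Otimes>\<^sub>M L)"
    unfolding split_beta
    by (intro borel_measurable_times class_density_measurable likelihood_measurable k) measurable
  show "0 \<le> f k (fst y) \<theta> * likelihood K n f (snd y) \<theta>"
    if "y \<in> space N" "\<theta> \<in> space L" for y \<theta>
    using that k unfolding space_L
    by (intro mult_nonneg_nonneg f_nonneg likelihood_nonneg) (auto simp: space_pair_measure)
qed (use k space_L lam_integrable lam_nonneg nn_integral_joint_density in auto)

lemma joint_weight_nonneg:
  assumes "k \<in> {1..K}" "y \<in> space N" "\<theta> \<in> \<Theta>"
  shows "0 \<le> joint_weight k y \<theta>"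
  using assms unfolding joint_weight_def
  by (intro mult_nonneg_nonneg lam_nonneg f_nonneg likelihood_nonneg) (auto simp: space_pair_measure)

lemma predictive_mass_nonneg:
  assumes "k \<in> {1..K}" "y \<in> space N"
  shows "0 \<le> predictive_mass k y"
  unfolding predictive_mass_def
  using joint_weight_nonneg[OF assms] space_L by (intro Bochner_Integration.integral_nonneg) auto

lemma prior_likelihood_measurable:
  "(\<lambda>(z, \<theta>). lam \<theta> * likelihood K n f z \<theta>) \<in> borel_measurable (T \<Otimes>\<^sub>M L)"
  unfolding split_beta by (intro borel_measurable_times likelihood_measurable) measurable

text \<open>
  Integrated over all training sets, the evidence gives the mass of the prior, so it is finite for almost
  every training set; the new vector does not enter.
\<close>

lemma AE_prior_likelihood_integrable:
  "AE y in N. integrable L (\<lambda>\<theta>. lam \<theta> * likelihood K n f (snd y) \<theta>)"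
proof -
  interpret TL: pair_sigma_finite T L by (rule pair_T_L)
  interpret MT: pair_sigma_finite M T by (rule pair_M_T)
  have int: "integrable (T \<Otimes>\<^sub>M L) (\<lambda>(z, \<theta>). lam \<theta> * likelihood K n f z \<theta>)"
  proof (rule TL.integrable_mixture_density)
    show "(\<lambda>(z, \<theta>). likelihood K n f z \<theta>) \<in> borel_measurable (T \<Otimes>\<^sub>M L)"
      unfolding split_beta by (intro likelihood_measurable) measurable
  qed (use space_L lam_integrable lam_nonneg likelihood_nonneg nn_integral_likelihood in auto)
  have [measurable]: "Measurable.pred T (\<lambda>z. integrable L (\<lambda>\<theta>. lam \<theta> * likelihood K n f z \<theta>))"
    by (rule TL.M2.borel_measurable_lebesgue_integrable[OF prior_likelihood_measurable])
  have "AE z in T. integrable L (\<lambda>\<theta>. lam \<theta> * likelihood K n f z \<theta>)"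
    using TL.AE_integrable_fst[OF int] .
  then show ?thesis
    by (intro MT.AE_pair_measure) auto
qed

lemma predictive_density_eq:
  "predictive_density K n f \<Theta> lam k x z = predictive_mass k (x, z) / evidence z"
proof -
  have "predictive_density K n f \<Theta> lam k x z = (LINT \<theta>|L. joint_weight k (x, z) \<theta> / evidence z)"
    unfolding predictive_density_def posterior_def evidence_def joint_weight_def
    by (intro Bochner_Integration.integral_cong) (auto simp: mult_ac)
  then show ?thesis
    by (simp add: predictive_mass_def)
qed

text \<open>
  A nonnegative integrable function with integral zero vanishes almost everywhere; here it is a factor
  of the joint weight.  Without integrability an evidence of \<open>0\<close> could be the default value of a
  divergent integral, and the conclusion could fail.
\<close>

lemma predictive_mass_eq_0:
  assumes int: "integrable L (\<lambda>\<theta>. lam \<theta> * likelihood K n f z \<theta>)"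
    and z: "z \<in> space T" and ev: "evidence z = 0"
  shows "predictive_mass k (x, z) = 0"
proof -
  have "AE \<theta> in L. lam \<theta> * likelihood K n f z \<theta> = 0"
    using ev space_L lam_nonneg likelihood_nonneg[OF z] unfolding evidence_def
    by (subst (asm) integral_nonneg_eq_0_iff_AE[OF int]) auto
  then have "AE \<theta> in L. joint_weight k (x, z) \<theta> = 0"
    by eventually_elim (auto simp: joint_weight_def)
  then show ?thesis
    unfolding predictive_mass_def by (rule integral_eq_zero_AE)
qed

text \<open>
  The evidence cancels from the quotient.  If it were zero all the predictive masses would be zero
  as well, contrary to the assumption on their weighted sum.
\<close>

lemma class_posterior_eq:
  assumes "integrable L (\<lambda>\<theta>. lam \<theta> * likelihood K n f z \<theta>)" "z \<in> space T"
    and S: "(\<Sum>t=1..K. w t * predictive_mass t (x, z)) \<noteq> 0"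
  shows "class_posterior K n f w \<Theta> lam k x z =
    w k * predictive_mass k (x, z) / (\<Sum>t=1..K. w t * predictive_mass t (x, z))"
proof -
  have "evidence z \<noteq> 0"
    using S predictive_mass_eq_0[OF assms(1,2)] by auto
  then show ?thesis
    unfolding class_posterior_def predictive_density_eq times_divide_eq_right
      sum_divide_distrib[symmetric]
    by simp
qed

end

section \<open>The total risk as an integral over observations\<close>

text \<open>
  With a dummy in place of the parameter, the loss can be taken out of integrals over the parameter.
\<close>

lemma loss_parameter: "loss c (k, \<theta>) t = loss c (k, ()) t"
  by (simp add: loss_def split: decision.split)

lemma abs_loss_le: "\<bar>loss c s t\<bar> \<le> 1 + \<bar>c\<bar>"
  by (auto simp: loss_def split: decision.split)

context parametric_classes
begin

lemma loss_measurable: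
  assumes "classification_rule M K n C"
  shows "(\<lambda>y. loss c s (C (fst y) (snd y))) \<in> borel_measurable N"
proof -
  have "(\<lambda>y. C (fst y) (snd y)) \<in> measurable N (count_space (decisions K))"
    using assms by (simp add: classification_rule_def split_beta)
  then show ?thesis
    by (rule measurable_compose) simp
qed

text \<open>
  The loss is bounded, so it preserves the integrability of the joint weight; this is the
  hypothesis of Fubini's theorem below.
\<close>

lemma weighted_loss_integrable:
  assumes C: "classification_rule M K n C" and k: "k \<in> {1..K}"
  shows "integrable (N \<Otimes>\<^sub>M L) (\<lambda>(y, \<theta>). joint_weight k y \<theta> * loss c s (C (fst y) (snd y)))"
proof (rule Bochner_Integration.integrable_bound)
  note [measurable] = borel_measurable_integrable[OF joint_weight_integrable[OF k]]
    loss_measurable[OF C]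
  show "integrable (N \<Otimes>\<^sub>M L) (\<lambda>v. (1 + \<bar>c\<bar>) * (case v of (y, \<theta>) \<Rightarrow> joint_weight k y \<theta>))"
    by (intro integrable_mult_right joint_weight_integrable k)
  show "(\<lambda>(y, \<theta>). joint_weight k y \<theta> * loss c s (C (fst y) (snd y))) \<in> borel_measurable (N \<Otimes>\<^sub>M L)"
    by measurable
  show "AE v in N \<Otimes>\<^sub>M L.
      norm (case v of (y, \<theta>) \<Rightarrow> joint_weight k y \<theta> * loss c s (C (fst y) (snd y)))
      \<le> norm ((1 + \<bar>c\<bar>) * (case v of (y, \<theta>) \<Rightarrow> joint_weight k y \<theta>))"
  proof (rule AE_I2)
    fix v
    have "\<bar>joint_weight k (fst v) (snd v)\<bar> * \<bar>loss c s (C (fst (fst v)) (snd (fst v)))\<bar> \<le>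
        \<bar>joint_weight k (fst v) (snd v)\<bar> * (1 + \<bar>c\<bar>)"
      by (intro mult_left_mono abs_loss_le) simp
    then show "norm (case v of (y, \<theta>) \<Rightarrow> joint_weight k y \<theta> * loss c s (C (fst y) (snd y)))
        \<le> norm ((1 + \<bar>c\<bar>) * (case v of (y, \<theta>) \<Rightarrow> joint_weight k y \<theta>))"
      by (simp add: split_beta abs_mult mult.commute)
  qed
qed

lemma risk_times_prior:
  assumes C: "classification_rule M K n C" and \<theta>: "\<theta> \<in> \<Theta>"
  shows "risk M K n f w c C \<theta> * lam \<theta> =
    (\<Sum>k=1..K. w k * (LINT y|N. joint_weight k y \<theta> * loss c (k, ()) (C (fst y) (snd y))))"
  unfolding risk_def sum_distrib_right
proof (rule sum.cong[OF refl])
  fix k assume k: "k \<in> {1..K}"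
  let ?l = "\<lambda>y. loss c (k, ()) (C (fst y) (snd y))"
  let ?q = "\<lambda>y. f k (fst y) \<theta> * likelihood K n f (snd y) \<theta>"
  have "(LINT (x, z)|joint_law M K n f k \<theta>. loss c (k, \<theta>) (C x z)) =
      (LINT y|density N (\<lambda>y. ennreal (?q y)). ?l y)"
    unfolding joint_law_eq_density[OF \<theta> k] split_beta by (simp add: loss_parameter[of c k \<theta>])
  also have "\<dots> = (LINT y|N. ?q y *\<^sub>R ?l y)"
    using f_nonneg[OF k _ \<theta>] likelihood_nonneg[OF _ \<theta>]
    by (intro integral_density loss_measurable C joint_density_section \<theta> k AE_I2 mult_nonneg_nonneg)
      (auto simp: space_pair_measure)
  finally have "w k * (LINT (x, z)|joint_law M K n f k \<theta>. loss c (k, \<theta>) (C x z)) * lam \<theta> =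
      w k * (lam \<theta> * (LINT y|N. ?q y *\<^sub>R ?l y))"
    by simp
  also have "\<dots> = w k * (LINT y|N. joint_weight k y \<theta> * ?l y)"
    unfolding integral_mult_right_zero[symmetric] by (simp add: joint_weight_def mult.assoc)
  finally show "w k * (LINT (x, z)|joint_law M K n f k \<theta>. loss c (k, \<theta>) (C x z)) * lam \<theta> =
      w k * (LINT y|N. joint_weight k y \<theta> * ?l y)" .
qed

lemma predictive_loss_integrable:
  assumes C: "classification_rule M K n C" and k: "k \<in> {1..K}"
  shows "integrable N (\<lambda>y. predictive_mass k y * loss c s (C (fst y) (snd y)))"
proof -
  interpret NL: pair_sigma_finite N L by (rule pair_N_L)
  show ?thesis
    using NL.integrable_fst[OF weighted_loss_integrable[OF C k]]
    by (simp add: predictive_mass_def)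
qed

text \<open>
  Interchanging the two integrals replaces an average over parameters of sampling risks by an average
  over data of posterior expected losses.  In the second form a rule can be optimised one observation
  at a time.
\<close>

lemma total_risk_eq:
  assumes C: "classification_rule M K n C"
  shows "total_risk M K n f w c \<Theta> lam C =
    (LINT y|N. (\<Sum>k=1..K. w k * predictive_mass k y * loss c (k, ()) (C (fst y) (snd y))))"
proof -
  interpret NL: pair_sigma_finite N L by (rule pair_N_L)
  let ?l = "\<lambda>k y. loss c (k, ()) (C (fst y) (snd y))"
  have "total_risk M K n f w c \<Theta> lam C =
      (LINT \<theta>|L. (\<Sum>k=1..K. w k * (LINT y|N. joint_weight k y \<theta> * ?l k y)))"
    unfolding total_risk_def using space_L
    by (intro Bochner_Integration.integral_cong refl risk_times_prior C) simp
  also have "\<dots> = (\<Sum>k=1..K. w k * (LINT \<theta>|L. LINT y|N. joint_weight k y \<theta> * ?l k y))"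
    by (subst Bochner_Integration.integral_sum)
      (auto intro!: integrable_mult_right NL.integrable_snd weighted_loss_integrable C)
  also have "\<dots> = (\<Sum>k=1..K. w k * (LINT y|N. LINT \<theta>|L. joint_weight k y \<theta> * ?l k y))"
    by (intro sum.cong refl arg_cong2[where f = "(*)"] NL.Fubini_integral
        weighted_loss_integrable C)
  also have "\<dots> = (\<Sum>k=1..K. w k * (LINT y|N. predictive_mass k y * ?l k y))"
    by (simp add: predictive_mass_def)
  also have "\<dots> = (LINT y|N. (\<Sum>k=1..K. w k * (predictive_mass k y * ?l k y)))"
    by (subst Bochner_Integration.integral_sum)
      (auto intro!: integrable_mult_right predictive_loss_integrable C)
  finally show ?thesis
    by (simp add: mult.assoc)
qed

section \<open>Optimality and existence of the predictive rule\<close>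

text \<open>
  The integrands compare pointwise wherever the evidence integral converges, hence almost everywhere.
\<close>

lemma predictive_rule_minimises_total_risk:
  assumes Chat: "classification_rule M K n Chat" "predictive_rule M K n f w c \<Theta> lam Chat"
    and C: "classification_rule M K n C"
  shows "total_risk M K n f w c \<Theta> lam Chat \<le> total_risk M K n f w c \<Theta> lam C"
  unfolding total_risk_eq[OF Chat(1)] total_risk_eq[OF C]
proof (rule integral_mono_AE)
  have int: "integrable N (\<lambda>y. \<Sum>k=1..K. w k * predictive_mass k y * loss c (k, ()) (R (fst y) (snd y)))"
    if "classification_rule M K n R" for R
    unfolding mult.assoc
    by (intro Bochner_Integration.integrable_sum integrable_mult_right predictive_loss_integrable that)
  show "integrable N (\<lambda>y. \<Sum>k=1..K. w k * predictive_mass k y * loss c (k, ()) (Chat (fst y) (snd y)))"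
    by (rule int[OF Chat(1)])
  show "integrable N (\<lambda>y. \<Sum>k=1..K. w k * predictive_mass k y * loss c (k, ()) (C (fst y) (snd y)))"
    by (rule int[OF C])
  show "AE y in N. (\<Sum>k=1..K. w k * predictive_mass k y * loss c (k, ()) (Chat (fst y) (snd y)))
      \<le> (\<Sum>k=1..K. w k * predictive_mass k y * loss c (k, ()) (C (fst y) (snd y)))"
    using AE_prior_likelihood_integrable AE_space
  proof eventually_elim
    fix y assume int: "integrable L (\<lambda>\<theta>. lam \<theta> * likelihood K n f (snd y) \<theta>)"
      and y: "y \<in> space N"
    obtain x z where xz: "y = (x, z)" "x \<in> space M" "z \<in> space T"
      using y by (auto simp: space_pair_measure)
    have "(\<Sum>k=1..K. w k * predictive_mass k (x, z) * loss c (k, ()) (Chat x z))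
        \<le> (\<Sum>k=1..K. w k * predictive_mass k (x, z) * loss c (k, ()) (C x z))"
    proof (rule posterior_decision_minimises_expected_loss)
      show "0 \<le> w k * predictive_mass k (x, z)" if "k \<in> {1..K}" for k
        using that y unfolding xz(1) by (intro mult_nonneg_nonneg w_nonneg predictive_mass_nonneg)
      show "\<forall>k\<in>{1..K}. class_posterior K n f w \<Theta> lam k x z =
          w k * predictive_mass k (x, z) / (\<Sum>k=1..K. w k * predictive_mass k (x, z))"
        if "(\<Sum>k=1..K. w k * predictive_mass k (x, z)) \<noteq> 0"
        using int that xz by (intro ballI class_posterior_eq) auto
      show "if \<forall>k\<in>{1..K}. class_posterior K n f w \<Theta> lam k x z \<le> 1 - c then Chat x z = Doubt
        else \<exists>k\<in>{1..K}. Chat x z = Class k \<and> class_posterior K n f w \<Theta> lam k x z =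
            Max ((\<lambda>k. class_posterior K n f w \<Theta> lam k x z) ` {1..K}) \<and>
          1 - c < class_posterior K n f w \<Theta> lam k x z"
        using Chat(2) xz(2,3) unfolding predictive_rule_def Let_def by blast
      show "C x z \<in> decisions K"
        using measurable_space[OF C[unfolded classification_rule_def] y] by (simp add: xz(1))
    qed
    then show "(\<Sum>k=1..K. w k * predictive_mass k y * loss c (k, ()) (Chat (fst y) (snd y)))
        \<le> (\<Sum>k=1..K. w k * predictive_mass k y * loss c (k, ()) (C (fst y) (snd y)))"
      by (simp add: xz)
  qed
qed

lemma class_posterior_measurable:
  assumes k: "k \<in> {1..K}"
  shows "(\<lambda>y. class_posterior K n f w \<Theta> lam k (fst y) (snd y)) \<in> borel_measurable N"
proof -
  interpret L: sigma_finite_measure L by (rule sigma_finite_L)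
  have mass: "(\<lambda>y. predictive_mass t y) \<in> borel_measurable N" if "t \<in> {1..K}" for t
    unfolding predictive_mass_def using joint_weight_integrable[OF that]
    by (intro L.borel_measurable_lebesgue_integral) simp
  have ev: "evidence \<in> borel_measurable T"
    unfolding evidence_def
    by (intro L.borel_measurable_lebesgue_integral prior_likelihood_measurable)
  show ?thesis
    unfolding class_posterior_def predictive_density_eq prod.collapse
    by (intro borel_measurable_divide borel_measurable_times borel_measurable_sum borel_measurable_const
        mass k measurable_compose[OF measurable_snd ev]) auto
qed

text \<open>
  Breaking ties in favour of the smallest class number keeps the choice measurable: the rule is then
  determined by finitely many comparisons between the measurable functions \<open>P(k | x, z)\<close>.
\<close>

lemma predictive_rule_exists:
  assumes K: "K \<ge> 1"
  shows "\<exists>Chat. classification_rule M K n Chat \<and> predictive_rule M K n f w c \<Theta> lam Chat"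
proof -
  define P where "P y k = class_posterior K n f w \<Theta> lam k (fst y) (snd y)" for y k
  have P_meas [measurable]: "(\<lambda>y. P y k) \<in> borel_measurable N" if "k \<in> {1..K}" for k
    unfolding P_def by (rule class_posterior_measurable[OF that])
  define best where "best y k \<longleftrightarrow> k \<in> {1..K} \<and> (\<forall>j\<in>{1..K}. P y j \<le> P y k)" for y k
  define R where "R y = (if \<forall>k\<in>{1..K}. P y k \<le> 1 - c then Doubt else Class (LEAST k. best y k))" for y
  have best_range: "k \<in> {1..K}" if "best y k" for y k
    using that by (simp add: best_def)
  have best: "best y (LEAST k. best y k)" for y
  proof (rule LeastI_ex)
    have "Max (P y ` {1..K}) \<in> P y ` {1..K}"
      using K by (intro Max_in) auto
    then obtain k where "k \<in> {1..K}" "Max (P y ` {1..K}) = P y k"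
      by auto
    moreover from this(2) have "P y j \<le> P y k" if "j \<in> {1..K}" for j
      using that by (metis Max_ge finite_atLeastAtMost finite_imageI imageI)
    ultimately show "\<exists>k. best y k"
      unfolding best_def by blast
  qed
  have best_pred: "Measurable.pred N (\<lambda>y. best y k)" for k
  proof (cases "k \<in> {1..K}")
    case True
    then show ?thesis
      unfolding best_def by measurable
  qed (simp add: best_def)
  have [measurable]: "(\<lambda>y. LEAST k. best y k) \<in> measurable N (count_space UNIV)"
    using best_pred by (rule measurable_Least)
  have R_meas: "R \<in> measurable N (count_space UNIV)"
    unfolding R_def by measurable
  have R_decision: "R y \<in> decisions K" for y
    using best_range[OF best[of y]] by (auto simp: R_def decisions_def)
  have "R \<in> measurable N (count_space (decisions K))"
  proof (subst measurable_count_space_eq2)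
    show "finite (decisions K)"
      by (simp add: decisions_def)
    show "R \<in> space N \<rightarrow> decisions K \<and> (\<forall>a\<in>decisions K. R -` {a} \<inter> space N \<in> sets N)"
      using R_decision measurable_sets[OF R_meas] by auto
  qed
  then have rule: "classification_rule M K n (\<lambda>x z. R (x, z))"
    by (simp add: classification_rule_def)
  have decide: "if \<forall>k\<in>{1..K}. P y k \<le> 1 - c then R y = Doubt
      else \<exists>k\<in>{1..K}. R y = Class k \<and> P y k = Max (P y ` {1..K}) \<and> P y k > 1 - c" for y
  proof (cases "\<forall>k\<in>{1..K}. P y k \<le> 1 - c")
    case True
    then show ?thesis
      by (simp add: R_def)
  next
    case False
    define k where "k = (LEAST k. best y k)"
    have "best y k"
      unfolding k_def by (rule best)
    then have k: "k \<in> {1..K}" "\<And>j. j \<in> {1..K} \<Longrightarrow> P y j \<le> P y k"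
      unfolding best_def by blast+
    have "R y = Class k"
      unfolding R_def k_def by (rule if_not_P[OF False])
    moreover have "P y k = Max (P y ` {1..K})"
      using k by (intro Max_eqI[symmetric]) auto
    moreover obtain j where "j \<in> {1..K}" "1 - c < P y j"
      using False not_le by blast
    then have "1 - c < P y k"
      using k(2) by fastforce
    ultimately show ?thesis
      unfolding if_not_P[OF False] using k(1) by blast
  qed
  have "predictive_rule M K n f w c \<Theta> lam (\<lambda>x z. R (x, z))"
    unfolding predictive_rule_def Let_def
  proof (intro ballI)
    fix x z
    show "if \<forall>k\<in>{1..K}. class_posterior K n f w \<Theta> lam k x z \<le> 1 - c then R (x, z) = Doubt
      else \<exists>k\<in>{1..K}. R (x, z) = Class k \<and> class_posterior K n f w \<Theta> lam k x z =
          Max ((\<lambda>k. class_posterior K n f w \<Theta> lam k x z) ` {1..K}) \<and>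
        1 - c < class_posterior K n f w \<Theta> lam k x z"
      using decide[of "(x, z)"] unfolding P_def fst_conv snd_conv .
  qed
  with rule show ?thesis
    by blast
qed

end

theorem theorem4p1:
  fixes M :: "'x measure"
    and K :: nat and n :: "nat \<Rightarrow> nat"
    and \<Theta> :: "(real ^ 'p) set"
    and f :: "nat \<Rightarrow> 'x \<Rightarrow> real ^ 'p \<Rightarrow> real"
    and w :: "nat \<Rightarrow> real"
    and lam :: "real ^ 'p \<Rightarrow> real"
    and c :: real
  assumes "sigma_finite_measure M"
    and "\<Theta> \<in> sets lebesgue"
    and f_meas: "\<And>k. k \<in> {1..K} \<Longrightarrow> (\<lambda>(x, \<theta>). f k x \<theta>) \<in> borel_measurable (M \<Otimes>\<^sub>M lebesgue_on \<Theta>)"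
    and f_nonneg: "\<And>k x \<theta>. k \<in> {1..K} \<Longrightarrow> x \<in> space M \<Longrightarrow> \<theta> \<in> \<Theta> \<Longrightarrow> 0 \<le> f k x \<theta>"
    and f_density: "\<And>k \<theta>. k \<in> {1..K} \<Longrightarrow> \<theta> \<in> \<Theta> \<Longrightarrow> (LINT x|M. f k x \<theta>) = 1"
    and w_nonneg: "\<And>k. k \<in> {1..K} \<Longrightarrow> 0 \<le> w k"
    and w_sum: "(\<Sum>k=1..K. w k) = 1"
    and lam_meas: "lam \<in> borel_measurable (lebesgue_on \<Theta>)"
    and lam_nonneg: "\<And>\<theta>. \<theta> \<in> \<Theta> \<Longrightarrow> 0 \<le> lam \<theta>"
    and lam_proper: "(LINT \<theta>|lebesgue_on \<Theta>. lam \<theta>) = 1"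
    and c_nonneg: "0 \<le> c"
  shows "(\<exists>Chat. classification_rule M K n Chat \<and> predictive_rule M K n f w c \<Theta> lam Chat) \<and>
    (\<forall>Chat. classification_rule M K n Chat \<and> predictive_rule M K n f w c \<Theta> lam Chat \<longrightarrow>
      (\<forall>C. classification_rule M K n C \<longrightarrow>
        total_risk M K n f w c \<Theta> lam Chat \<le> total_risk M K n f w c \<Theta> lam C))"
proof -
  have "integrable (lebesgue_on \<Theta>) lam"
    using lam_proper not_integrable_integral_eq by fastforce
  then interpret parametric_classes M K n \<Theta> f w lam
    by (intro parametric_classes.intro parametric_classes_axioms.intro assms)
  have "K \<ge> 1"
    using w_sum by (cases K) auto
  then show ?thesis
    using predictive_rule_exists predictive_rule_minimises_total_risk by blast
qed

end
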